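(* Let $A$ be a coherent quantale and let $a\in A$ be a w-pure element which is radical, i.e. $\rho(a)=a$. Then $a=\rho(\mathrm{Ker}(a))$ and $\mathrm{Ker}(a)=\mathrm{Vir}(a)$.
   Context: A quantale is a complete lattice $(A,\vee,\wedge,0,1)$ with an associative multiplication distributing over arbitrary joins in each variable. All quantales are assumed commutative and integral ($1$ is the multiplicative unit). $K(A)$ is the set of compact elements of $A$. $A$ is algebraic if every element is a join of compact elements; $A$ is coherent if it is algebraic, $1\in K(A)$ and $K(A)$ is closed under multiplication. Residuation: $a\rightarrow b=\bigvee\{x\in A: ax\le b\}$, and $a^{\perp}=a\rightarrow 0$. An element $p<1$ is $m$-prime if $ab\le p$ implies $a\le p$ or $b\le p$ for all $a,b\in A$; $\mathrm{Spec}(A)$ is the set of $m$-prime elements. The radical of $a$ is $\rho(a)=\bigwedge\{p\in \mathrm{Spec}(A): a\le p\}$. An element $a\in A$ is pure if for all $c\in K(A)$, $c\le a$ implies $a\vee c^{\perp}=1$; $\mathrm{Vir}(A)$ denotes the set of pure elements. An element $a$ is w-pure if for all $c\in K(A)$, $c\le a$ implies $a\vee(c\rightarrow\rho(0))=1$. For $a\in A$: $\mathrm{Ker}(a)=\bigvee\{c\in K(A): c\le a,\ a\vee c^{\perp}=1\}$ and $\mathrm{Vir}(a)=\bigvee\{b\in \mathrm{Vir}(A): b\le a\}$. *)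

theory Defs
  imports Main
begin

text \<open>
  Commutative integral quantales. The least element \<open>0\<close> of the quantale is \<open>bot\<close>. The greatest
  element is \<open>top\<close>; integrality identifies it with the multiplicative unit \<open>1\<close>. By commutativity,
  distributivity over joins in one variable gives distributivity in both.
\<close>

class quantale = complete_lattice + comm_monoid_mult +
  assumes mult_Sup_distrib: "a * Sup B = Sup ((\<lambda>b. a * b) ` B)"
    and one_eq_top: "1 = top"

definition (in complete_lattice) compact_elements :: "'a set" where
  "compact_elements = {c. \<forall>X. c \<le> Sup X \<longrightarrow> (\<exists>F\<subseteq>X. finite F \<and> c \<le> Sup F)}"

class coherent_quantale = quantale +
  assumes algebraic: "\<exists>C\<subseteq>compact_elements. a = Sup C"
    and one_compact: "1 \<in> compact_elements"
    and mult_compact: "\<lbrakk>c \<in> compact_elements; d \<in> compact_elements\<rbrakk> \<Longrightarrow> c * d \<in> compact_elements"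

definition residual :: "'a::quantale \<Rightarrow> 'a \<Rightarrow> 'a" where
  "residual a b = Sup {x. a * x \<le> b}"

definition perp :: "'a::quantale \<Rightarrow> 'a" where
  "perp a = residual a bot"

definition m_prime :: "'a::quantale \<Rightarrow> bool" where
  "m_prime p \<longleftrightarrow> p < 1 \<and> (\<forall>a b. a * b \<le> p \<longrightarrow> a \<le> p \<or> b \<le> p)"

definition Spec :: "'a::quantale set" where
  "Spec = {p. m_prime p}"

definition radical :: "'a::quantale \<Rightarrow> 'a" where
  "radical a = Inf {p \<in> Spec. a \<le> p}"

definition pure_element :: "'a::quantale \<Rightarrow> bool" where
  "pure_element a \<longleftrightarrow> (\<forall>c \<in> compact_elements. c \<le> a \<longrightarrow> sup a (perp c) = 1)"

definition w_pure :: "'a::quantale \<Rightarrow> bool" where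
  "w_pure a \<longleftrightarrow> (\<forall>c \<in> compact_elements. c \<le> a \<longrightarrow> sup a (residual c (radical bot)) = 1)"

definition Ker :: "'a::quantale \<Rightarrow> 'a" where
  "Ker a = Sup {c \<in> compact_elements. c \<le> a \<and> sup a (perp c) = 1}"

text \<open>
  \<open>Vir\<close> is the operator on elements; the set \<open>Vir(A)\<close> of pure elements is
  \<open>{b. pure_element b}\<close>.
\<close>

definition Vir :: "'a::quantale \<Rightarrow> 'a" where
  "Vir a = Sup {b. pure_element b \<and> b \<le> a}"

end

theory Submission
  imports Defs
begin

text \<open>
  By Krull's lemma a compact \<open>c\<close> lies below \<open>\<rho>(x)\<close> only if a power of \<open>c\<close> lies below \<open>x\<close>. If
  \<open>c \<le> a\<close> is compact, w-purity gives a compact \<open>e\<close> with \<open>a \<or> e = 1\<close> and \<open>c e \<le> \<rho>(0)\<close>, hence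
  \<open>c\<^sup>n e\<^sup>n = 0\<close>; since still \<open>a \<or> e\<^sup>n = 1\<close>, this puts \<open>c\<^sup>n\<close> below \<open>Ker(a)\<close>, so \<open>c \<le> \<rho>(Ker(a))\<close>.
  Moreover \<open>\<rho>(x) \<or> y = 1\<close> forces \<open>x \<or> y = 1\<close> (Krull's lemma for \<open>c = 1\<close>), so \<open>a = \<rho>(Ker(a))\<close>
  may be replaced by \<open>Ker(a)\<close> in \<open>a \<or> c\<^sup>\<bottom> = 1\<close>, which makes \<open>Ker(a)\<close> pure.
\<close>

section \<open>Arithmetic of commutative integral quantales\<close>

lemma le_one_quantale: "a \<le> (1::'a::quantale)"
  by (simp add: one_eq_top)

lemma mult_sup_distrib: "a * sup b c = sup (a * b) (a * c)" for a :: "'a::quantale"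
  using mult_Sup_distrib[of a "{b, c}"] by simp

lemma mult_sup_distrib_right: "sup b c * a = sup (b * a) (c * a)" for a :: "'a::quantale"
  by (metis mult_sup_distrib mult.commute)

lemma mult_bot_quantale: "a * bot = bot" for a :: "'a::quantale"
  using mult_Sup_distrib[of a "{}"] by simp

lemma mult_left_mono_quantale: "b \<le> c \<Longrightarrow> a * b \<le> a * c" for a :: "'a::quantale"
  by (metis mult_sup_distrib sup.absorb_iff2)

lemma mult_mono_quantale:
  fixes a :: "'a::quantale"
  assumes "a \<le> b" and "c \<le> d"
  shows "a * c \<le> b * d"
  using mult_left_mono_quantale[OF assms(1), of c] mult_left_mono_quantale[OF assms(2), of b]
  by (simp add: mult.commute)

lemma mult_le_left_quantale: "a * b \<le> a" for a :: "'a::quantale"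
  using mult_left_mono_quantale[OF le_one_quantale, of a b] by simp

lemma mult_le_right_quantale: "a * b \<le> b" for a :: "'a::quantale"
  by (metis mult_le_left_quantale mult.commute)

text \<open>When the product is expanded, every term except \<open>u * v\<close> has a factor
  \<open>p\<close>, so integrality puts it below \<open>p\<close>. This serves both the stability of
  \<open>sup a x = 1\<close> under products and the primality argument in Krull's lemma.\<close>

lemma sup_mult_sup_le: "sup p u * sup p v \<le> sup p (u * v)" for p :: "'a::quantale"
  by (simp add: mult_sup_distrib mult_sup_distrib_right le_supI1
      mult_le_left_quantale mult_le_right_quantale)

lemma sup_mult_eq_one:
  fixes a :: "'a::quantale"
  assumes "sup a x = 1" and "sup a y = 1"
  shows "sup a (x * y) = 1"
  using sup_mult_sup_le[of a x y] assms by (simp add: order.antisym le_one_quantale)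

lemma sup_power_eq_one:
  fixes a :: "'a::quantale"
  assumes "sup a x = 1"
  shows "sup a (x ^ n) = 1"
proof (induction n)
  case 0
  show ?case by (simp add: one_eq_top)
next
  case (Suc n)
  then show ?case by (simp add: sup_mult_eq_one assms)
qed

lemma sup_eq_one_mono: "sup a x = 1 \<Longrightarrow> a \<le> b \<Longrightarrow> x \<le> y \<Longrightarrow> sup b y = (1::'a::quantale)"
  by (metis le_one_quantale order.antisym sup_mono)

section \<open>Residuation and annihilators\<close>

lemma le_residual_iff: "x \<le> residual a b \<longleftrightarrow> a * x \<le> b"
proof
  have "a * residual a b \<le> b"
    unfolding residual_def mult_Sup_distrib by (rule Sup_least) auto
  then show "a * x \<le> b" if "x \<le> residual a b"
    using mult_left_mono_quantale[OF that] order.trans by blast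
qed (simp add: residual_def Sup_upper)

lemma le_perp_iff: "x \<le> perp a \<longleftrightarrow> a * x = bot"
  by (simp add: perp_def le_residual_iff bot_unique)

lemma perp_antimono: "a \<le> b \<Longrightarrow> perp b \<le> perp a"
  unfolding perp_def residual_def
  by (rule Sup_subset_mono) (blast intro: order.trans mult_mono_quantale[OF _ order.refl])

section \<open>Compact elements\<close>

lemma compact_elements_iff:
  "c \<in> compact_elements \<longleftrightarrow> (\<forall>X. c \<le> Sup X \<longrightarrow> (\<exists>F\<subseteq>X. finite F \<and> c \<le> Sup F))"
  by (simp add: compact_elements_def)

lemma Sup_compact:
  assumes "finite F" and "F \<subseteq> compact_elements"
  shows "Sup F \<in> compact_elements"
  unfolding compact_elements_iff
proof (intro allI impI)
  fix X assume "Sup F \<le> Sup X"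
  then have "\<forall>c\<in>F. \<exists>G\<subseteq>X. finite G \<and> c \<le> Sup G"
    using assms(2) compact_elements_iff by (meson Sup_le_iff subsetD)
  then obtain G where G: "\<And>c. c \<in> F \<Longrightarrow> G c \<subseteq> X \<and> finite (G c) \<and> c \<le> Sup (G c)"
    by metis
  have "Sup F \<le> Sup (\<Union>c\<in>F. G c)"
    by (rule Sup_least) (meson G Sup_subset_mono UN_upper order.trans)
  then show "\<exists>F'\<subseteq>X. finite F' \<and> Sup F \<le> Sup F'"
    using G assms(1) by (intro exI[of _ "\<Union>c\<in>F. G c"]) auto
qed

lemma power_compact: "c \<in> compact_elements \<Longrightarrow> c ^ n \<in> compact_elements"
  for c :: "'a::coherent_quantale"
  by (induction n) (auto simp: one_compact mult_compact)

lemma le_if_compact_le: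
  fixes a :: "'a::coherent_quantale"
  assumes "\<And>c. c \<in> compact_elements \<Longrightarrow> c \<le> a \<Longrightarrow> c \<le> b"
  shows "a \<le> b"
proof -
  obtain C where "C \<subseteq> compact_elements" and "a = Sup C"
    using algebraic by blast
  then show ?thesis
    using assms by (auto intro!: Sup_least Sup_upper)
qed

lemma sup_eq_one_compact:
  fixes a :: "'a::coherent_quantale"
  assumes "sup a y = 1"
  obtains e where "e \<in> compact_elements" and "e \<le> y" and "sup a e = 1"
proof -
  obtain C where C: "C \<subseteq> compact_elements" and y: "y = Sup C"
    using algebraic by blast
  have "1 \<le> Sup (insert a C)"
    using assms y by simp
  then obtain F where F: "F \<subseteq> insert a C" "finite F" "1 \<le> Sup F"
    using one_compact compact_elements_iff by metis
  show thesis
  \<comment> \<open>The element \<open>a\<close> need not be compact, so it is taken out of the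
    finite subcover; what remains is a finite set of compact elements below
    \<open>y\<close>.\<close>
  proof (rule that)
    show "Sup (F - {a}) \<in> compact_elements"
      using F C by (intro Sup_compact) auto
    show "Sup (F - {a}) \<le> y"
      unfolding y using F by (intro Sup_subset_mono) auto
    have "Sup F \<le> sup a (Sup (F - {a}))"
      by (rule Sup_least) (metis DiffI Sup_upper le_supI2 singletonD sup.cobounded1)
    then show "sup a (Sup (F - {a})) = 1"
      using F(3) le_one_quantale by (meson order.antisym order.trans)
  qed
qed

section \<open>The radical and Krull's lemma\<close>

lemma le_radical: "a \<le> radical a"
  unfolding radical_def by (auto intro: Inf_greatest)

lemma radical_mono: "a \<le> b \<Longrightarrow> radical a \<le> radical b"
  unfolding radical_def by (rule Inf_superset_mono) auto

lemma m_prime_power_le: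
  assumes "m_prime p" and "c ^ n \<le> p"
  shows "c \<le> p"
  using assms(2)
proof (induction n)
  case 0
  with assms(1) show ?case by (auto simp: m_prime_def)
next
  case (Suc n)
  with assms(1) show ?case by (auto simp: m_prime_def)
qed

lemma le_radical_power: "c \<le> radical (c ^ n)"
  unfolding radical_def Spec_def by (rule Inf_greatest) (blast dest: m_prime_power_le)

text \<open>In the Zorn argument below, this turns a finite subcover taken from a chain into a
  single member of the chain.\<close>

lemma finite_chain_Sup_mem:
  fixes F :: "'a::complete_lattice set"
  assumes "finite F" and "F \<noteq> {}" and "\<And>x y. x \<in> F \<Longrightarrow> y \<in> F \<Longrightarrow> x \<le> y \<or> y \<le> x"
  shows "Sup F \<in> F"
  using assms
proof (induction F rule: finite_ne_induct)
  case (insert x F)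
  then have "Sup F \<in> F" by blast
  with insert.prems have "x \<le> Sup F \<or> Sup F \<le> x" by blast
  with \<open>Sup F \<in> F\<close> show ?case by (auto simp: sup.absorb1 sup.absorb2)
qed simp

text \<open>Krull's lemma: an element maximal among those above \<open>x\<close> and above no power of \<open>c\<close> is m-prime.\<close>

lemma compact_le_radicalD:
  fixes c x :: "'a::coherent_quantale"
  assumes c: "c \<in> compact_elements" and le: "c \<le> radical x"
  obtains n where "c ^ n \<le> x"
proof (rule ccontr)
  assume "\<not> thesis"
  then have nx: "\<not> c ^ n \<le> x" for n using that by blast
  define A where "A = {y. x \<le> y \<and> (\<forall>n. \<not> c ^ n \<le> y)}"
  have xA: "x \<in> A" using nx by (simp add: A_def)
  have "\<exists>p\<in>A. \<forall>y\<in>A. p \<le> y \<longrightarrow> y = p"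
  proof (rule predicate_Zorn)
    show "partial_order_on A (relation_of (\<le>) A)"
      by (rule partial_order_on_relation_ofI) auto
    fix C assume "C \<in> Chains (relation_of (\<le>) A)"
    then have CA: "C \<subseteq> A" and chain: "\<And>y z. y \<in> C \<Longrightarrow> z \<in> C \<Longrightarrow> y \<le> z \<or> z \<le> y"
      by (auto simp: Chains_def relation_of_def)
    \<comment> \<open>Inserting \<open>x\<close> gives the empty chain a bound in \<open>A\<close>
      as well. Since \<open>c ^ n\<close> is compact, it could lie below this join only if it lay
      below a single member of \<open>A\<close>.\<close>
    have "\<not> c ^ n \<le> Sup (insert x C)" for n
    proof
      assume "c ^ n \<le> Sup (insert x C)"
      then obtain F where F: "F \<subseteq> insert x C" "finite F" "c ^ n \<le> Sup F"
        using power_compact[OF c, of n] compact_elements_iff by metis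
      have "Sup (insert x F) \<in> insert x F"
      proof (rule finite_chain_Sup_mem)
        fix y z assume "y \<in> insert x F" "z \<in> insert x F"
        then have "y \<in> insert x C" "z \<in> insert x C" using F by auto
        then show "y \<le> z \<or> z \<le> y" using CA chain by (auto simp: A_def)
      qed (use F in auto)
      moreover have "insert x F \<subseteq> A"
        using F(1) CA xA by blast
      ultimately have "Sup (insert x F) \<in> A" by (rule rev_subsetD)
      moreover have "c ^ n \<le> Sup (insert x F)"
        using F(3) by (simp add: le_supI2)
      ultimately show False by (auto simp: A_def)
    qed
    then have "Sup (insert x C) \<in> A" by (simp add: A_def)
    then show "\<exists>u\<in>A. \<forall>y\<in>C. y \<le> u" by (meson Sup_upper insertI2)
  qed
  then obtain p where pA: "p \<in> A" and max: "\<And>y. y \<in> A \<Longrightarrow> p \<le> y \<Longrightarrow> y = p"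
    by blast
  \<comment> \<open>By maximality of \<open>p\<close>, an element strictly above \<open>p\<close> is
    outside \<open>A\<close>; being above \<open>x\<close>, it must lie above some power of
    \<open>c\<close>.\<close>
  have power_le: "\<exists>n. c ^ n \<le> sup p u" if "\<not> u \<le> p" for u
  proof (rule ccontr)
    assume "\<not> ?thesis"
    then have "sup p u \<in> A" using pA by (auto simp: A_def le_supI1)
    then have "sup p u = p" using max by simp
    with that show False by (simp add: sup.absorb_iff1)
  qed
  have "m_prime p"
    unfolding m_prime_def
  proof (intro conjI allI impI)
    \<comment> \<open>The exponent 0 is included in the definition of \<open>A\<close> for this
      purpose: \<open>c ^ 0 = 1\<close> makes \<open>p\<close> proper.\<close>
    have "\<not> c ^ 0 \<le> p" using pA unfolding A_def by blast
    then show "p < 1" using le_one_quantale[of p] by (auto simp: less_le)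
    fix u v assume uv: "u * v \<le> p"
    show "u \<le> p \<or> v \<le> p"
    proof (rule ccontr)
      assume "\<not> ?thesis"
      then obtain m n where "c ^ m \<le> sup p u" "c ^ n \<le> sup p v"
        using power_le by blast
      then have "c ^ (m + n) \<le> sup p u * sup p v"
        unfolding power_add by (rule mult_mono_quantale)
      also have "\<dots> \<le> sup p (u * v)" by (rule sup_mult_sup_le)
      also have "\<dots> = p" using uv by (simp add: sup.absorb1)
      finally show False using pA by (simp add: A_def)
    qed
  qed
  then have "radical x \<le> p"
    using pA unfolding radical_def by (auto simp: A_def Spec_def intro!: Inf_lower)
  then have "c ^ 1 \<le> p" using le by simp
  then show False using pA unfolding A_def by blast
qed

lemma sup_radical_eq_one:
  fixes x y :: "'a::coherent_quantale"
  assumes "sup (radical x) y = 1"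
  shows "sup x y = 1"
proof -
  have "sup (radical x) y \<le> radical (sup x y)"
    by (meson radical_mono le_radical le_supI order.trans sup.cobounded1 sup.cobounded2)
  then have "1 \<le> radical (sup x y)" by (simp add: assms)
  then obtain n where "1 ^ n \<le> sup x y"
    using compact_le_radicalD[OF one_compact] by blast
  then show ?thesis by (simp add: order.antisym le_one_quantale)
qed

section \<open>The operators \<open>Ker\<close> and \<open>Vir\<close>\<close>

lemma Ker_le: "Ker a \<le> a"
  unfolding Ker_def by (auto intro: Sup_least)

text \<open>A compact \<open>c\<close> below a pure \<open>b \<le> a\<close> is itself a joinand of
  \<open>Ker a\<close>, because \<open>sup b (perp c) = 1\<close> survives enlarging
  \<open>b\<close> to \<open>a\<close>.\<close>

lemma Vir_le_Ker: "Vir a \<le> Ker a" for a :: "'a::coherent_quantale"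
  unfolding Vir_def
proof (rule Sup_least, clarify)
  fix b assume b: "pure_element b" "b \<le> a"
  show "b \<le> Ker a"
  proof (rule le_if_compact_le)
    fix c :: 'a assume c: "c \<in> compact_elements" "c \<le> b"
    then have "sup b (perp c) = 1" using b by (simp add: pure_element_def)
    then have "sup a (perp c) = 1" using b(2) sup_eq_one_mono by blast
    then show "c \<le> Ker a"
      unfolding Ker_def using c b(2) by (auto intro: Sup_upper)
  qed
qed

text \<open>The product of the annihilators of finitely many elements annihilates their join, and
  \<open>sup a _ = 1\<close> is stable under products.\<close>

lemma sup_perp_Sup_eq_one:
  assumes "finite F" and "\<And>c. c \<in> F \<Longrightarrow> sup a (perp c) = 1"
  shows "sup a (perp (Sup F)) = 1"
  using assms
proof (induction F rule: finite_induct)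
  case empty
  have "perp bot = (1::'a)"
    by (metis le_perp_iff mult_bot_quantale mult.commute order.antisym le_one_quantale)
  then show ?case by (simp add: one_eq_top)
next
  case (insert c F)
  have "c * (perp c * perp (Sup F)) = bot"
    by (rule le_perp_iff[THEN iffD1, OF mult_le_left_quantale])
  moreover have "Sup F * (perp c * perp (Sup F)) = bot"
    by (rule le_perp_iff[THEN iffD1, OF mult_le_right_quantale])
  ultimately have "perp c * perp (Sup F) \<le> perp (Sup (insert c F))"
    by (simp add: le_perp_iff mult_sup_distrib_right)
  moreover have "sup a (perp c * perp (Sup F)) = 1"
    using insert by (simp add: sup_mult_eq_one)
  ultimately show ?case using sup_eq_one_mono by blast
qed

text \<open>By compactness \<open>c\<close> lies below a finite join of joinands of
  \<open>Ker a\<close>, and \<open>perp\<close> is antitone.\<close>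

lemma compact_le_KerD:
  assumes "c \<in> compact_elements" and "c \<le> Ker a"
  shows "sup a (perp c) = 1"
proof -
  obtain F where F: "F \<subseteq> {c \<in> compact_elements. c \<le> a \<and> sup a (perp c) = 1}"
      "finite F" "c \<le> Sup F"
    using assms(1)[unfolded compact_elements_iff, rule_format, OF assms(2)[unfolded Ker_def]] by blast
  then have "sup a (perp (Sup F)) = 1" by (intro sup_perp_Sup_eq_one) auto
  then show ?thesis using sup_eq_one_mono[OF _ order.refl perp_antimono[OF F(3)]] by blast
qed

lemma w_pure_le_radical_Ker:
  fixes a :: "'a::coherent_quantale"
  assumes "w_pure a"
  shows "a \<le> radical (Ker a)"
proof (rule le_if_compact_le)
  fix c :: 'a assume c: "c \<in> compact_elements" "c \<le> a"
  then have "sup a (residual c (radical bot)) = 1"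
    using assms by (simp add: w_pure_def)
  then obtain e where e: "e \<in> compact_elements" "e \<le> residual c (radical bot)" "sup a e = 1"
    by (rule sup_eq_one_compact)
  then obtain n where "(c * e) ^ n \<le> bot"
    using compact_le_radicalD[OF mult_compact[OF c(1) e(1)]] le_residual_iff by metis
  then have "e ^ n \<le> perp (c ^ n)"
    by (simp add: le_perp_iff power_mult_distrib bot_unique)
  then have perp: "sup a (perp (c ^ n)) = 1"
    using sup_eq_one_mono[OF sup_power_eq_one[OF e(3)] order.refl] by blast
  have "c ^ n \<le> a"
  proof (cases n)
    case 0
    \<comment> \<open>For \<open>n = 0\<close> the bound \<open>c \<le> a\<close> gives nothing
      about \<open>c ^ n = 1\<close>; instead \<open>sup a (perp 1) = 1\<close> collapses to
      \<open>a = 1\<close>.\<close>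
    have "perp 1 = (bot::'a)" by (metis le_perp_iff mult_1 order.refl)
    with perp 0 show ?thesis by simp
  next
    case (Suc m)
    then show ?thesis
      using c(2) mult_le_left_quantale[of c "c ^ m"] by simp
  qed
  then have "c ^ n \<le> Ker a"
    unfolding Ker_def using perp power_compact[OF c(1)] by (auto intro: Sup_upper)
  then show "c \<le> radical (Ker a)"
    using le_radical_power radical_mono order.trans by blast
qed

theorem theorem4p14:
  fixes a :: "'a::coherent_quantale"
  assumes "w_pure a" and "radical a = a"
  shows "a = radical (Ker a) \<and> Ker a = Vir a"
proof
  show eq: "a = radical (Ker a)"
    using w_pure_le_radical_Ker[OF assms(1)] radical_mono[OF Ker_le, of a] assms(2)
    by (simp add: order.antisym)
  have "pure_element (Ker a)"
    unfolding pure_element_def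
  proof (intro ballI impI)
    fix c :: 'a assume "c \<in> compact_elements" "c \<le> Ker a"
    then have "sup (radical (Ker a)) (perp c) = 1"
      using compact_le_KerD eq by metis
    then show "sup (Ker a) (perp c) = 1" by (rule sup_radical_eq_one)
  qed
  then have "Ker a \<le> Vir a"
    unfolding Vir_def using Ker_le by (auto intro: Sup_upper)
  then show "Ker a = Vir a"
    using Vir_le_Ker by (rule order.antisym)
qed

end
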